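(* There exist a constant $c>0$ and, for each $n \ge 1$, a language $L_n$ accepted by a DFA with $O(n)$ states that is not factor-free and such that every witness $(v,w)$ to the failure of factor-freeness of $L_n$ satisfies $|w| \ge c n^2$; i.e. the smallest witness has size $\Omega(n^2)$.
   Context: A word $v$ is a factor of $w$ if $w = xvy$ for some words $x,y$. $L$ is factor-free if no word of $L$ has a factor different from itself that lies in $L$. A witness to the failure of factor-freeness is a pair $(v,w)$ with $v,w \in L$, $v$ a factor of $w$, $v \ne w$; its size is $|w|$. *)

theory Defs
  imports Complex_Main "HOL-Library.Sublist" "HOL-Library.Landau_Symbols"
begin

text \<open>
  The relation \<open>factor of\<close> on words is the library's \<^const>\<open>sublist\<close>.
\<close>

definition factor_free :: "'a list set \<Rightarrow> bool" where
  "factor_free L \<longleftrightarrow> (\<forall>w\<in>L. \<forall>v. sublist v w \<and> v \<noteq> w \<longrightarrow> v \<notin> L)"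

definition factor_witness :: "'a list set \<Rightarrow> 'a list \<Rightarrow> 'a list \<Rightarrow> bool" where
  "factor_witness L v w \<longleftrightarrow> v \<in> L \<and> w \<in> L \<and> sublist v w \<and> v \<noteq> w"

definition min_witness_size :: "'a list set \<Rightarrow> nat" where
  "min_witness_size L = (LEAST m. \<exists>v w. factor_witness L v w \<and> length w = m)"

text \<open>
  Complete deterministic finite automata over an alphabet \<open>\<Sigma>\<close>. Values of the transition
  function outside \<open>states M \<times> \<Sigma>\<close> are irrelevant.
\<close>

record ('q, 'a) dfa =
  states :: "'q set"
  init :: 'q
  final :: "'q set"
  trans :: "'q \<Rightarrow> 'a \<Rightarrow> 'q"

definition is_dfa :: "'a set \<Rightarrow> ('q, 'a) dfa \<Rightarrow> bool" where
  "is_dfa \<Sigma> M \<longleftrightarrow> finite \<Sigma> \<and> finite (states M) \<and> init M \<in> states M \<and> final M \<subseteq> states M \<and>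
     (\<forall>q\<in>states M. \<forall>a\<in>\<Sigma>. trans M q a \<in> states M)"

definition dfa_language :: "'a set \<Rightarrow> ('q, 'a) dfa \<Rightarrow> 'a list set" where
  "dfa_language \<Sigma> M = {w \<in> lists \<Sigma>. foldl (trans M) (init M) w \<in> final M}"

end

theory Submission
  imports Defs
begin

text \<open>
  The language consists of the words \<open>1 0\<^sup>k 1\<close> with \<open>n dvd k + 1\<close> and the words \<open>2 1 0\<^sup>k 1\<close>
  with \<open>n + 1 dvd k + 1\<close>. Every member contains the letter 1 exactly twice, so a member can be a
  proper factor of another one only as \<open>1 0\<^sup>k 1\<close> inside \<open>2 1 0\<^sup>k 1\<close>. Then \<open>k + 1\<close> is divisible
  by the coprime numbers \<open>n\<close> and \<open>n + 1\<close>, hence at least \<open>n (n + 1)\<close>. Two disjoint cycles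
  of lengths \<open>n\<close> and \<open>n + 1\<close> suffice to check the divisibility conditions.
\<close>

section \<open>The language and its automaton\<close>

definition two_cycle_lang :: "nat \<Rightarrow> nat list set" where
  "two_cycle_lang n = {1 # replicate k 0 @ [1] | k. n dvd Suc k} \<union>
     {2 # 1 # replicate k 0 @ [1] | k. Suc n dvd Suc k}"

text \<open>
  State 0 is initial, 1 is accepting, 2 is a sink and 3 is reached by the prefix \<open>2\<close>.
  The cycles are \<open>{4..<4 + n}\<close> and \<open>{4 + n..<5 + 2 * n}\<close>.
\<close>

definition two_cycle_step :: "nat \<Rightarrow> nat \<Rightarrow> nat \<Rightarrow> nat" where
  "two_cycle_step n q a =
    (if q = 0 then (if a = 1 then 4 else if a = 2 then 3 else 2)
     else if q < 3 then 2
     else if q = 3 then (if a = 1 then 4 + n else 2)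
     else if q < 4 + n then
       (if a = 0 then 4 + Suc (q - 4) mod n else if a = 1 \<and> Suc (q - 4) = n then 1 else 2)
     else (if a = 0 then 4 + n + Suc (q - (4 + n)) mod Suc n
           else if a = 1 \<and> q - (4 + n) = n then 1 else 2))"

definition two_cycle_dfa :: "nat \<Rightarrow> (nat, nat) dfa" where
  "two_cycle_dfa n =
    \<lparr>states = {..<5 + 2 * n}, init = 0, final = {1}, trans = two_cycle_step n\<rparr>"

lemma is_dfa_two_cycle_dfa:
  assumes "n \<ge> 1"
  shows "is_dfa {0, 1, 2} (two_cycle_dfa n)"
proof -
  have "two_cycle_step n q a < 5 + 2 * n" for q a
  proof -
    \<comment> \<open>The reduced offsets keep each cycle inside its own block of states.\<close>
    have "Suc (q - 4) mod n < n" "Suc (q - (4 + n)) mod Suc n < Suc n"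
      using assms by simp_all
    then show ?thesis
      unfolding two_cycle_step_def by auto
  qed
  then show ?thesis
    by (simp add: is_dfa_def two_cycle_dfa_def)
qed

section \<open>Accepting runs\<close>

lemma foldl_two_cycle_step_sink: "foldl (two_cycle_step n) 2 w = 2"
  by (induction w) (simp_all add: two_cycle_step_def)

lemma foldl_two_cycle_step_accepting: "foldl (two_cycle_step n) 1 w = 1 \<longleftrightarrow> w = []"
  by (cases w) (simp_all add: two_cycle_step_def foldl_two_cycle_step_sink)

text \<open>Handles both cycles at once. The offset \<open>r\<close> in state \<open>b + r\<close>
  counts zeros modulo \<open>m\<close>, and the letter 1 accepts only from the last offset
  \<open>m - 1\<close>; this is why \<open>Suc (r + k)\<close> appears. The offset is generalized
  because reading 0 moves it.\<close>

lemma foldl_cycle_eq_accept_iff: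
  fixes d :: "nat \<Rightarrow> nat \<Rightarrow> nat"
  assumes zero: "\<And>r. r < m \<Longrightarrow> d (b + r) 0 = b + Suc r mod m"
    and nonzero: "\<And>r a. r < m \<Longrightarrow> a \<noteq> 0 \<Longrightarrow> d (b + r) a = (if a = 1 \<and> Suc r = m then acc else sink)"
    and sink: "\<And>w. foldl d sink w \<noteq> acc"
    and acc: "\<And>w. foldl d acc w = acc \<longleftrightarrow> w = []"
    and notin: "acc < b"
    and "r < m"
  shows "foldl d (b + r) w = acc \<longleftrightarrow> (\<exists>k. w = replicate k 0 @ [1] \<and> m dvd Suc (r + k))"
  using \<open>r < m\<close>
proof (induction w arbitrary: r)
  case Nil
  then show ?case using notin by simp
next
  case (Cons a w)
  show ?case
  proof (cases "a = 0")
    case True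
    have "foldl d (b + r) (a # w) = foldl d (b + Suc r mod m) w"
      using True zero Cons.prems by simp
    also have "\<dots> = acc \<longleftrightarrow> (\<exists>k. w = replicate k 0 @ [1] \<and> m dvd Suc (Suc r mod m + k))"
      using Cons.prems by (intro Cons.IH) simp
    also have "\<dots> \<longleftrightarrow> (\<exists>k. w = replicate k 0 @ [1] \<and> m dvd Suc (r + Suc k))"
    proof -
      \<comment> \<open>Wrapping around the cycle preserves the residue modulo
        \<open>m\<close>.\<close>
      have "Suc (Suc r mod m + k) mod m = Suc (r + Suc k) mod m" for k
        by (metis add_Suc add_Suc_right mod_Suc_eq mod_add_left_eq)
      then show ?thesis
        by (simp only: dvd_eq_mod_eq_0)
    qed
    also have "\<dots> \<longleftrightarrow> (\<exists>k. a # w = replicate k 0 @ [1] \<and> m dvd Suc (r + k))" (is "?L \<longleftrightarrow> ?R")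
    proof
      assume ?L
      then obtain k where "w = replicate k 0 @ [1]" "m dvd Suc (r + Suc k)" by blast
      then show ?R using True by (intro exI[of _ "Suc k"]) simp
    next
      assume ?R
      then obtain k where k: "a # w = replicate k 0 @ [1]" "m dvd Suc (r + k)" by blast
      then obtain k' where "k = Suc k'" using True by (cases k) auto
      then show ?L using k by auto
    qed
    finally show ?thesis .
  next
    case False
    \<comment> \<open>As \<open>r < m\<close>, the only multiple of \<open>m\<close> that
      \<open>Suc r\<close> can be is \<open>m\<close> itself.\<close>
    have "m dvd Suc r \<longleftrightarrow> Suc r = m"
      using Cons.prems by (metis Suc_leI dvd_imp_le dvd_refl le_antisym zero_less_Suc)
    moreover have "(\<exists>k. a # w = replicate k 0 @ [1] \<and> m dvd Suc (r + k)) \<longleftrightarrow>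
        a = 1 \<and> w = [] \<and> m dvd Suc r" (is "?L \<longleftrightarrow> ?R")
    proof
      assume ?L
      then obtain k where k: "a # w = replicate k 0 @ [1]" "m dvd Suc (r + k)" by blast
      then have "k = 0" using False by (cases k) auto
      then show ?R using k by simp
    next
      assume ?R
      then show ?L by (intro exI[of _ 0]) simp
    qed
    ultimately show ?thesis
      using False nonzero[OF Cons.prems False] sink acc by auto
  qed
qed

lemma foldl_two_cycle_step_first:
  assumes "n \<ge> 1"
  shows "foldl (two_cycle_step n) 4 w = 1 \<longleftrightarrow> (\<exists>k. w = replicate k 0 @ [1] \<and> n dvd Suc k)"
proof -
  \<comment> \<open>The explicit \<open>+ 0\<close> exposes the form \<open>b + r\<close> with
    \<open>r = 0\<close>.\<close>
  have "foldl (two_cycle_step n) (4 + 0) w = 1 \<longleftrightarrow>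
      (\<exists>k. w = replicate k 0 @ [1] \<and> n dvd Suc (0 + k))"
    by (rule foldl_cycle_eq_accept_iff[where sink = 2])
      (use assms in \<open>simp_all add: two_cycle_step_def foldl_two_cycle_step_sink
         foldl_two_cycle_step_accepting[unfolded One_nat_def]\<close>)
  then show ?thesis by simp
qed

lemma foldl_two_cycle_step_second:
  "foldl (two_cycle_step n) (4 + n) w = 1 \<longleftrightarrow> (\<exists>k. w = replicate k 0 @ [1] \<and> Suc n dvd Suc k)"
proof -
  have "foldl (two_cycle_step n) (4 + n + 0) w = 1 \<longleftrightarrow>
      (\<exists>k. w = replicate k 0 @ [1] \<and> Suc n dvd Suc (0 + k))"
    by (rule foldl_cycle_eq_accept_iff[where sink = 2])
      (simp_all add: two_cycle_step_def foldl_two_cycle_step_sink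
         foldl_two_cycle_step_accepting[unfolded One_nat_def])
  then show ?thesis by simp
qed

lemma foldl_two_cycle_step_three:
  "foldl (two_cycle_step n) 3 w = 1 \<longleftrightarrow> (\<exists>k. w = 1 # replicate k 0 @ [1] \<and> Suc n dvd Suc k)"
proof (cases w)
  case Nil
  then show ?thesis by simp
next
  case (Cons a u)
  have "two_cycle_step n 3 a = (if a = 1 then 4 + n else 2)"
    by (simp add: two_cycle_step_def)
  then show ?thesis
    using Cons foldl_two_cycle_step_second[of n u] foldl_two_cycle_step_sink[of n u] by auto
qed

lemma foldl_two_cycle_step_init:
  assumes "n \<ge> 1"
  shows "foldl (two_cycle_step n) 0 w = 1 \<longleftrightarrow> w \<in> two_cycle_lang n"
proof (cases w)
  case Nil
  then show ?thesis by (simp add: two_cycle_lang_def)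
next
  case (Cons a u)
  have "two_cycle_step n 0 a = (if a = 1 then 4 else if a = 2 then 3 else 2)"
    by (simp add: two_cycle_step_def)
  then show ?thesis
    using Cons foldl_two_cycle_step_first[OF assms, of u] foldl_two_cycle_step_three[of n u]
      foldl_two_cycle_step_sink[of n u]
    by (auto simp: two_cycle_lang_def)
qed

lemma two_cycle_lang_subset_lists: "two_cycle_lang n \<subseteq> lists {0, 1, 2}"
  by (auto simp: two_cycle_lang_def)

lemma dfa_language_two_cycle_dfa:
  assumes "n \<ge> 1"
  shows "dfa_language {0, 1, 2} (two_cycle_dfa n) = two_cycle_lang n"
  using two_cycle_lang_subset_lists[of n] foldl_two_cycle_step_init[OF assms]
  by (auto simp: dfa_language_def two_cycle_dfa_def)

section \<open>Shape and length of witnesses\<close>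

lemma count_list_two_cycle_lang:
  "w \<in> two_cycle_lang n \<Longrightarrow> count_list w 1 = 2"
proof -
  have "count_list (replicate k (0::nat)) (Suc 0) = 0" for k
    by (simp add: count_list_0_iff)
  then show "w \<in> two_cycle_lang n \<Longrightarrow> count_list w 1 = 2"
    by (auto simp: two_cycle_lang_def)
qed

lemma factor_witness_two_cycle_langD:
  assumes "factor_witness (two_cycle_lang n) v w"
  obtains k where "w = 2 # 1 # replicate k 0 @ [1]" "n dvd Suc k" "Suc n dvd Suc k"
proof -
  from assms have v: "v \<in> two_cycle_lang n" and w: "w \<in> two_cycle_lang n" and "v \<noteq> w"
    and "sublist v w"
    by (auto simp: factor_witness_def)
  then obtain xs ys where split: "w = xs @ v @ ys"
    by (auto simp: sublist_def)
  then have "count_list xs 1 = 0" "count_list ys 1 = 0"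
    using count_list_two_cycle_lang[OF v] count_list_two_cycle_lang[OF w] by auto
  then have no_one: "1 \<notin> set xs" "1 \<notin> set ys"
    by (simp_all add: count_list_0_iff)
  \<comment> \<open>A nonempty \<open>ys\<close> would end in a letter other than 1.\<close>
  have "last w = 1"
    using w by (auto simp: two_cycle_lang_def)
  then have "ys = []"
    using split no_one(2) by (cases ys rule: rev_cases) auto
  then have xs: "w = xs @ v" "xs \<noteq> []"
    using split \<open>v \<noteq> w\<close> by auto
  then obtain x xs' where x: "xs = x # xs'"
    by (cases xs) auto
  then have "x \<noteq> 1"
    using no_one by auto
  then obtain k where k: "w = 2 # 1 # replicate k 0 @ [1]" "Suc n dvd Suc k"
    using w xs x by (auto simp: two_cycle_lang_def)
  \<comment> \<open>The second letter of \<open>w\<close> is 1, so the prefix free of 1 stops after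
    the 2.\<close>
  then have "xs' = []"
    using xs x no_one(1) by (cases xs') auto
  then have "v = 1 # replicate k 0 @ [1]"
    using xs x k by simp
  then have "n dvd Suc k"
    using v by (auto simp: two_cycle_lang_def)
  then show thesis
    using k that by blast
qed

lemma factor_witness_two_cycle_lang_length:
  assumes "factor_witness (two_cycle_lang n) v w"
  shows "n ^ 2 \<le> length w"
proof -
  obtain k where k: "w = 2 # 1 # replicate k 0 @ [1]" "n dvd Suc k" "Suc n dvd Suc k"
    using factor_witness_two_cycle_langD[OF assms] .
  \<comment> \<open>Consecutive numbers are coprime, so their product divides every common
    multiple.\<close>
  have "n * Suc n dvd Suc k"
    using k(2,3) by (intro divides_mult) simp_all
  then have "n * Suc n \<le> Suc k"
    by (rule dvd_imp_le) simp
  then show ?thesis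
    using k(1) by (simp add: power2_eq_square)
qed

lemma factor_witness_two_cycle_lang_ex:
  assumes "n \<ge> 1"
  shows "\<exists>v w. factor_witness (two_cycle_lang n) v w"
proof -
  \<comment> \<open>Makes \<open>Suc k\<close> the least positive common multiple of
    \<open>n\<close> and \<open>Suc n\<close>.\<close>
  define k where "k = n * Suc n - 1"
  have k: "Suc k = n * Suc n"
    using assms by (simp add: k_def)
  have "n dvd Suc k" "Suc n dvd Suc k"
    by (simp_all only: k dvd_triv_left dvd_triv_right)
  then have "factor_witness (two_cycle_lang n)
      (1 # replicate k 0 @ [1]) (2 # 1 # replicate k 0 @ [1])"
    by (auto simp: factor_witness_def two_cycle_lang_def sublist_Cons_right)
  then show ?thesis by blast
qed

lemma factor_free_iff_no_witness: "factor_free L \<longleftrightarrow> \<not> (\<exists>v w. factor_witness L v w)"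
  by (auto simp: factor_free_def factor_witness_def)

text \<open>Existence of a witness makes the \<open>LEAST\<close> attained, so it is the length of
  an actual witness and inherits the bound.\<close>

lemma le_min_witness_sizeI:
  assumes "\<exists>v w. factor_witness L v w"
    and "\<And>v w. factor_witness L v w \<Longrightarrow> m \<le> length w"
  shows "m \<le> min_witness_size L"
proof -
  have "\<exists>v w. factor_witness L v w \<and> length w = min_witness_size L"
    unfolding min_witness_size_def by (rule LeastI_ex) (use assms(1) in blast)
  then show ?thesis
    using assms(2) by metis
qed

theorem theorem9:
  "\<exists>(\<Sigma> :: nat set) (c :: real) (L :: nat \<Rightarrow> nat list set) (M :: nat \<Rightarrow> (nat, nat) dfa).
     finite \<Sigma> \<and> c > 0 \<and>
     (\<forall>n\<ge>1. is_dfa \<Sigma> (M n) \<and> dfa_language \<Sigma> (M n) = L n \<and>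
            \<not> factor_free (L n) \<and>
            (\<forall>v w. factor_witness (L n) v w \<longrightarrow> real (length w) \<ge> c * real n ^ 2)) \<and>
     (\<lambda>n. real (card (states (M n)))) \<in> O(\<lambda>n. real n) \<and>
     (\<lambda>n. real (min_witness_size (L n))) \<in> \<Omega>(\<lambda>n. real n ^ 2)"
proof (intro exI conjI allI impI)
  show "finite {0, 1, 2 :: nat}" by simp
  show "(1 :: real) > 0" by simp
next
  fix n :: nat
  assume n: "n \<ge> 1"
  show "is_dfa {0, 1, 2} (two_cycle_dfa n)"
    using n by (rule is_dfa_two_cycle_dfa)
  show "dfa_language {0, 1, 2} (two_cycle_dfa n) = two_cycle_lang n"
    using n by (rule dfa_language_two_cycle_dfa)
  show "\<not> factor_free (two_cycle_lang n)"
    using factor_witness_two_cycle_lang_ex[OF n] by (simp add: factor_free_iff_no_witness)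
next
  fix n v w
  assume "factor_witness (two_cycle_lang n) v w"
  then have "n ^ 2 \<le> length w"
    by (rule factor_witness_two_cycle_lang_length)
  then have "real (n ^ 2) \<le> real (length w)"
    by (rule of_nat_mono)
  then show "1 * real n ^ 2 \<le> real (length w)"
    by simp
next
  show "(\<lambda>n. real (card (states (two_cycle_dfa n)))) \<in> O(\<lambda>n. real n)"
  \<comment> \<open>There are \<open>5 + 2 * n\<close> states, at most \<open>7 * n\<close> once
    \<open>n \<ge> 1\<close>.\<close>
  proof (rule bigoI[of _ 7])
    show "\<forall>\<^sub>F n in sequentially. norm (real (card (states (two_cycle_dfa n)))) \<le> 7 * norm (real n)"
      using eventually_ge_at_top[of 1] by eventually_elim (simp add: two_cycle_dfa_def)
  qed
next
  show "(\<lambda>n. real (min_witness_size (two_cycle_lang n))) \<in> \<Omega>(\<lambda>n. real n ^ 2)"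
  proof (rule landau_omega.bigI[of 1])
    show "\<forall>\<^sub>F n in sequentially.
        norm (real (min_witness_size (two_cycle_lang n))) \<ge> 1 * norm (real n ^ 2)"
      \<comment> \<open>For these \<open>n\<close> a witness exists, so the minimum is
        attained.\<close>
      using eventually_ge_at_top[of 1]
    proof eventually_elim
      case (elim n)
      have "n ^ 2 \<le> min_witness_size (two_cycle_lang n)"
        using factor_witness_two_cycle_lang_ex[OF elim] factor_witness_two_cycle_lang_length
        by (rule le_min_witness_sizeI)
      then have "real (n ^ 2) \<le> real (min_witness_size (two_cycle_lang n))"
        by (rule of_nat_mono)
      then show ?case by simp
    qed
  qed simp
qed

end
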